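(* Let $(A,d)$ be a differential graded ring. Suppose that in $\ker(d)$ the set of left regular homogeneous elements and the set of right regular homogeneous elements coincide. Then $(A,d)$ is a dg-division algebra if and only if $\ker(d)$ is a gr-division algebra.
   Context: Rings are associative with unit. For a commutative ring $K$, a dg-$K$-algebra $(A,d)$ is a $\mathbb{Z}$-graded $K$-algebra $A$ with a graded $K$-linear endomorphism $d$ of degree $1$ such that $d^2=0$ and $d(ab)=d(a)b+(-1)^{|a|}a\,d(b)$ for all homogeneous $a,b\in A$. A differential graded ring (dg-ring) is a dg-$\mathbb{Z}$-algebra. Then $\ker(d)$ is a $\mathbb{Z}$-graded subring of $A$ (the ring of cycles). A dg-left (resp. dg-right) ideal of $(A,d)$ is a $\mathbb{Z}$-graded left (resp. right) ideal $I$ with $d(I)\subseteq I$. $(A,d)$ is a dg-division algebra if it contains no dg-left ideal and no dg-right ideal other than $0$ and $A$. A graded ring is a gr-division algebra if all its nonzero homogeneous elements are invertible. A homogeneous element $u$ of $\ker(d)$ is right regular in $\ker(d)$ if $ux=0$ with $x\in\ker(d)$ implies $x=0$, and left regular in $\ker(d)$ if $xu=0$ with $x\in\ker(d)$ implies $x=0$. *)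

theory Defs
  imports "HOL-Algebra.Algebra"
begin

text \<open>
  Rings are those of the locale \<^locale>\<open>ring\<close>: associative, with unit, not necessarily
  commutative; the zero ring is allowed.
\<close>

text \<open>
  The subgroup \<open>H\<close> of the additive group of \<open>R\<close> is the internal direct sum of the subgroups
  \<open>G n\<close>; \<open>f n\<close> is the homogeneous component of degree \<open>n\<close>.
\<close>
definition internal_direct_sum ::
    "('a, 'm) ring_scheme \<Rightarrow> 'a set \<Rightarrow> (int \<Rightarrow> 'a set) \<Rightarrow> bool" where
  "internal_direct_sum R H G \<longleftrightarrow>
     (\<forall>n. additive_subgroup (G n) R \<and> G n \<subseteq> H) \<and>
     (\<forall>a\<in>H. \<exists>!f. (\<forall>n. f n \<in> G n) \<and> finite {n. f n \<noteq> \<zero>\<^bsub>R\<^esub>} \<and>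
                    a = finsum R f {n. f n \<noteq> \<zero>\<^bsub>R\<^esub>})"

locale graded_ring = ring R for R (structure) +
  fixes G :: "int \<Rightarrow> 'a set"
  assumes grading: "internal_direct_sum R (carrier R) G"
    and graded_mult: "\<lbrakk>a \<in> G m; b \<in> G n\<rbrakk> \<Longrightarrow> a \<otimes> b \<in> G (m + n)"

definition homogeneous :: "(int \<Rightarrow> 'a set) \<Rightarrow> 'a \<Rightarrow> bool" where
  "homogeneous G a \<longleftrightarrow> (\<exists>n. a \<in> G n)"

locale gr_division_algebra = graded_ring +
  assumes homogeneous_invertible: "\<lbrakk>homogeneous G a; a \<noteq> \<zero>\<rbrakk> \<Longrightarrow> a \<in> Units R"

text \<open>
  A dg-algebra over the integers: linearity over the integers is additivity, and the sign
  \<open>(-1)\<^sup>m\<close> of the Leibniz rule is resolved by the parity of the degree \<open>m\<close> of \<open>a\<close>.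
\<close>
locale dg_ring = graded_ring +
  fixes d :: "'a \<Rightarrow> 'a"
  assumes d_additive: "d \<in> hom (add_monoid R) (add_monoid R)"
    and d_degree: "a \<in> G n \<Longrightarrow> d a \<in> G (n + 1)"
    and d_squared: "a \<in> carrier R \<Longrightarrow> d (d a) = \<zero>"
    and leibniz: "\<lbrakk>a \<in> G m; b \<in> G n\<rbrakk> \<Longrightarrow>
      d (a \<otimes> b) = d a \<otimes> b \<oplus> (if even m then a \<otimes> d b else \<ominus> (a \<otimes> d b))"

definition cycle_ring :: "('a, 'm) ring_scheme \<Rightarrow> ('a \<Rightarrow> 'a) \<Rightarrow> ('a, 'm) ring_scheme" where
  "cycle_ring R d = R\<lparr>carrier := a_kernel R R d\<rparr>"

definition cycle_grading ::
    "('a, 'm) ring_scheme \<Rightarrow> (int \<Rightarrow> 'a set) \<Rightarrow> ('a \<Rightarrow> 'a) \<Rightarrow> int \<Rightarrow> 'a set" where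
  "cycle_grading R G d n = G n \<inter> a_kernel R R d"

text \<open>An ideal \<open>I\<close> is graded if it is the direct sum of its intersections with the \<open>G n\<close>.\<close>

definition dg_left_ideal ::
    "('a, 'm) ring_scheme \<Rightarrow> (int \<Rightarrow> 'a set) \<Rightarrow> ('a \<Rightarrow> 'a) \<Rightarrow> 'a set \<Rightarrow> bool" where
  "dg_left_ideal R G d I \<longleftrightarrow>
     additive_subgroup I R \<and>
     (\<forall>r\<in>carrier R. \<forall>a\<in>I. r \<otimes>\<^bsub>R\<^esub> a \<in> I) \<and>
     internal_direct_sum R I (\<lambda>n. I \<inter> G n) \<and>
     d ` I \<subseteq> I"

definition dg_right_ideal ::
    "('a, 'm) ring_scheme \<Rightarrow> (int \<Rightarrow> 'a set) \<Rightarrow> ('a \<Rightarrow> 'a) \<Rightarrow> 'a set \<Rightarrow> bool" where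
  "dg_right_ideal R G d I \<longleftrightarrow>
     additive_subgroup I R \<and>
     (\<forall>r\<in>carrier R. \<forall>a\<in>I. a \<otimes>\<^bsub>R\<^esub> r \<in> I) \<and>
     internal_direct_sum R I (\<lambda>n. I \<inter> G n) \<and>
     d ` I \<subseteq> I"

locale dg_division_algebra = dg_ring +
  assumes dg_left_ideal_trivial: "dg_left_ideal R G d I \<Longrightarrow> I = {\<zero>} \<or> I = carrier R"
    and dg_right_ideal_trivial: "dg_right_ideal R G d I \<Longrightarrow> I = {\<zero>} \<or> I = carrier R"

definition right_regular :: "('a, 'm) ring_scheme \<Rightarrow> 'a \<Rightarrow> bool" where
  "right_regular S u \<longleftrightarrow>
     u \<in> carrier S \<and> (\<forall>x\<in>carrier S. u \<otimes>\<^bsub>S\<^esub> x = \<zero>\<^bsub>S\<^esub> \<longrightarrow> x = \<zero>\<^bsub>S\<^esub>)"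

definition left_regular :: "('a, 'm) ring_scheme \<Rightarrow> 'a \<Rightarrow> bool" where
  "left_regular S u \<longleftrightarrow>
     u \<in> carrier S \<and> (\<forall>x\<in>carrier S. x \<otimes>\<^bsub>S\<^esub> u = \<zero>\<^bsub>S\<^esub> \<longrightarrow> x = \<zero>\<^bsub>S\<^esub>)"

end

theory Submission
  imports Defs
begin

text \<open>
  If \<open>u \<noteq> 0\<close> is a homogeneous cycle, then \<open>A u\<close> and \<open>u A\<close> are dg-ideals, because \<open>d\<close> commutes up
  to sign with multiplication by \<open>u\<close>. In a dg-division algebra both are therefore \<open>A\<close>, so \<open>u\<close> has a
  two-sided inverse \<open>v\<close>; from \<open>0 = d (v u) = d v u\<close> it follows that \<open>v\<close> is a cycle. Conversely, a
  nonzero dg-ideal contains a nonzero homogeneous \<open>a\<close>, and one of \<open>a\<close>, \<open>d a\<close> is a nonzero homogeneous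
  cycle, hence a unit.
\<close>

section \<open>Finite sums in a substructure\<close>

text \<open>\<open>finsum\<close> depends on the carrier, so a sum of cycles formed in the ring of
  cycles has to be compared with the one formed in the ambient ring. Both obey the same recursion on
  the index set.\<close>

lemma (in abelian_monoid) finsum_carrier_update:
  assumes "\<zero> \<in> K" and "K \<subseteq> carrier G"
    and closed: "\<And>x y. \<lbrakk>x \<in> K; y \<in> K\<rbrakk> \<Longrightarrow> x \<oplus> y \<in> K"
    and "abelian_monoid (G\<lparr>carrier := K\<rparr>)"
    and "finite S" and "f \<in> S \<rightarrow> K"
  shows "finsum (G\<lparr>carrier := K\<rparr>) f S = finsum G f S \<and> finsum G f S \<in> K"
proof -
  interpret K: abelian_monoid "G\<lparr>carrier := K\<rparr>" by fact
  show ?thesis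
    using \<open>finite S\<close> \<open>f \<in> S \<rightarrow> K\<close>
  proof (induction S)
    case empty
    show ?case using K.finsum_empty \<open>\<zero> \<in> K\<close> by simp
  next
    case (insert s S)
    have "f \<in> S \<rightarrow> K" "f s \<in> K" "f \<in> S \<rightarrow> carrier G" "f s \<in> carrier G"
      using insert.prems \<open>K \<subseteq> carrier G\<close> by auto
    with insert show ?case
      using K.finsum_insert[of S s f] finsum_insert[of S s f] closed by simp
  qed
qed

section \<open>Homogeneous components in a graded ring\<close>

context graded_ring
begin

lemma additive_subgroup_G: "additive_subgroup (G n) R"
  using grading by (simp add: internal_direct_sum_def)

lemma G_closed: "a \<in> G n \<Longrightarrow> a \<in> carrier R"
  using grading by (auto simp: internal_direct_sum_def)

lemma zero_in_G: "\<zero> \<in> G n"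
  by (rule additive_subgroup.zero_closed[OF additive_subgroup_G])

text \<open>The component family of \<open>a\<close>, indexed by degree. The description is
  justified for \<open>a\<close> in the carrier, where the grading gives existence and
  uniqueness.\<close>

definition comp :: "'a \<Rightarrow> int \<Rightarrow> 'a" where
  "comp a = (THE f. (\<forall>n. f n \<in> G n) \<and> finite {n. f n \<noteq> \<zero>} \<and> a = finsum R f {n. f n \<noteq> \<zero>})"

lemma comp_ex1:
  "a \<in> carrier R \<Longrightarrow>
    \<exists>!f. (\<forall>n. f n \<in> G n) \<and> finite {n. f n \<noteq> \<zero>} \<and> a = finsum R f {n. f n \<noteq> \<zero>}"
  using grading by (simp add: internal_direct_sum_def)

lemma
  assumes "a \<in> carrier R"
  shows comp_in_G: "comp a n \<in> G n"
    and finite_comp: "finite {n. comp a n \<noteq> \<zero>}"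
    and finsum_comp: "finsum R (comp a) {n. comp a n \<noteq> \<zero>} = a"
  using theI'[OF comp_ex1[OF assms], folded comp_def] by simp_all

lemma comp_closed: "a \<in> carrier R \<Longrightarrow> comp a n \<in> carrier R"
  by (rule G_closed[OF comp_in_G])

text \<open>Zero summands do not matter, so several component families can be summed over one common
  finite set.\<close>

lemma finsum_support:
  assumes "\<And>n. f n \<in> carrier R" and "finite S" and "{n. f n \<noteq> \<zero>} \<subseteq> S"
  shows "finsum R f {n. f n \<noteq> \<zero>} = finsum R f S"
  by (rule add.finprod_mono_neutral_cong_left) (use assms in auto)

text \<open>Uniqueness of the decomposition. Any finite \<open>S\<close> around the support will do,
  so exact supports need not be computed.\<close>

lemma comp_eqI:
  assumes G: "\<And>n. f n \<in> G n" and S: "finite S" "{n. f n \<noteq> \<zero>} \<subseteq> S"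
    and a: "a = finsum R f S"
  shows "comp a = f"
proof -
  have "a \<in> carrier R"
    unfolding a by (rule finsum_closed) (use G_closed[OF G] in auto)
  moreover have "a = finsum R f {n. f n \<noteq> \<zero>}"
    unfolding a by (rule finsum_support[symmetric]) (use G_closed[OF G] S in auto)
  moreover have "finite {n. f n \<noteq> \<zero>}"
    using S by (rule finite_subset[rotated])
  ultimately show ?thesis
    unfolding comp_def using G by (intro the1_equality comp_ex1) simp_all
qed

lemma comp_homogeneous:
  assumes "a \<in> G m"
  shows "comp a = (\<lambda>n. if n = m then a else \<zero>)"
proof (rule comp_eqI[where S = "{m}"])
  show "a = (\<Oplus>n\<in>{m}. if n = m then a else \<zero>)"
    using finsum_singleton[of m "{m}" "\<lambda>_. a"] G_closed[OF assms]
    by (simp add: finsum_insert[of "{}" m])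
qed (use assms zero_in_G in auto)

lemma comp_add:
  assumes a: "a \<in> carrier R" and b: "b \<in> carrier R"
  shows "comp (a \<oplus> b) = (\<lambda>n. comp a n \<oplus> comp b n)"
proof -
  \<comment> \<open>The support of the sum may be strictly smaller than this union, because
    components can cancel.\<close>
  let ?S = "{n. comp a n \<noteq> \<zero>} \<union> {n. comp b n \<noteq> \<zero>}"
  have fin: "finite ?S" using finite_comp a b by simp
  have "a = finsum R (comp a) ?S" "b = finsum R (comp b) ?S"
    using finsum_support[of "comp a" ?S] finsum_support[of "comp b" ?S]
      finsum_comp comp_closed a b fin by auto
  then have "a \<oplus> b = (\<Oplus>n\<in>?S. comp a n \<oplus> comp b n)"
    using finsum_addf[of "comp a" ?S "comp b"] comp_closed a b by auto
  moreover have "comp a n \<oplus> comp b n \<in> G n" for n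
    using comp_in_G a b by (intro additive_subgroup.a_closed[OF additive_subgroup_G])
  ultimately show ?thesis
    using fin by (intro comp_eqI[where S = ?S]) auto
qed

text \<open>An element of a subgroup stable under components is the finite sum of its components, so
  additive properties reduce to homogeneous elements. The induction stays inside \<open>I\<close>,
  which matters when \<open>I\<close> is the set of cycles.\<close>

lemma graded_induct [consumes 3, case_names homogeneous add]:
  assumes I: "additive_subgroup I R"
    and comp: "\<forall>a\<in>I. \<forall>n. comp a n \<in> I"
    and a: "a \<in> I"
    and hom: "\<And>n a. \<lbrakk>a \<in> I; a \<in> G n\<rbrakk> \<Longrightarrow> P a"
    and add: "\<And>a b. \<lbrakk>a \<in> I; b \<in> I; P a; P b\<rbrakk> \<Longrightarrow> P (a \<oplus> b)"
  shows "P a"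
proof -
  interpret I: additive_subgroup I R by fact
  have ac: "a \<in> carrier R" using a by (rule I.a_Hcarr)
  \<comment> \<open>Membership in \<open>I\<close> is carried along because \<open>add\<close> asks
    for it. The empty sum is covered by \<open>hom\<close>, as \<open>\<zero>\<close> lies in every
    degree.\<close>
  have "finsum R (comp a) S \<in> I \<and> P (finsum R (comp a) S)" if "finite S" for S
    using that
  proof (induction S)
    case empty
    show ?case using hom[OF I.zero_closed zero_in_G] by simp
  next
    case (insert s S)
    moreover have "P (comp a s)" using comp a comp_in_G[OF ac] by (blast intro: hom)
    ultimately show ?case using add comp a comp_closed[OF ac] by simp
  qed
  from this[OF finite_comp[OF ac]] show ?thesis using finsum_comp[OF ac] by simp
qed

lemma additive_subgroup_carrier: "additive_subgroup (carrier R) R"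
  by (rule additive_subgroupI) (rule add.subgroup_self)

lemma comp_carrier: "\<forall>a\<in>carrier R. \<forall>n. comp a n \<in> carrier R"
  using comp_closed by blast

lemmas carrier_induct [consumes 1, case_names homogeneous add] =
  graded_induct[OF additive_subgroup_carrier comp_carrier]

text \<open>Right multiplication by \<open>u\<close> shifts degrees by \<open>m\<close>. Both sides
  are additive in \<open>a\<close>, so homogeneous \<open>a\<close> suffices.\<close>

lemma comp_mult_right:
  assumes a: "a \<in> carrier R" and u: "u \<in> G m"
  shows "comp (a \<otimes> u) n = comp a (n - m) \<otimes> u"
  using a
proof (induction a rule: carrier_induct)
  case (homogeneous k a)
  then show ?case
    using comp_homogeneous[OF graded_mult[OF _ u]] comp_homogeneous G_closed[OF u] by auto
next
  case (add a b)
  then show ?case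
    using G_closed[OF u] comp_closed by (simp add: l_distr comp_add)
qed

lemma comp_mult_left:
  assumes a: "a \<in> carrier R" and u: "u \<in> G m"
  shows "comp (u \<otimes> a) n = u \<otimes> comp a (n - m)"
  using a
proof (induction a rule: carrier_induct)
  case (homogeneous k a)
  then show ?case
    using comp_homogeneous[OF graded_mult[OF u]] comp_homogeneous G_closed[OF u] by auto
next
  case (add a b)
  then show ?case
    using G_closed[OF u] comp_closed by (simp add: r_distr comp_add)
qed

text \<open>The degree-zero component of \<open>1\<close> is a right identity, by comparing degrees in \<open>a = a 1\<close>.\<close>

lemma one_in_G: "\<one> \<in> G 0"
proof -
  let ?e = "comp \<one> 0"
  have "a \<otimes> ?e = a" if "a \<in> carrier R" for a
    using that
  proof (induction a rule: carrier_induct)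
    case (homogeneous k a)
    then show ?case
      using comp_mult_left[OF one_closed, of a k k] by (simp add: comp_homogeneous)
  next
    case (add a b)
    then show ?case using comp_closed by (simp add: l_distr)
  qed
  from this[OF one_closed] show ?thesis
    using comp_in_G[OF one_closed, of 0] comp_closed by simp
qed

section \<open>Graded subgroups\<close>

text \<open>The ambient components already lie in \<open>I\<close>, and uniqueness is inherited from
  the ambient grading.\<close>

lemma internal_direct_sumI:
  assumes I: "additive_subgroup I R" and comp: "\<forall>a\<in>I. \<forall>n. comp a n \<in> I"
  shows "internal_direct_sum R I (\<lambda>n. I \<inter> G n)"
  unfolding internal_direct_sum_def
proof (intro conjI allI ballI)
  fix n
  show "additive_subgroup (I \<inter> G n) R"
    using I additive_subgroup_G[of n]
    by (auto simp: additive_subgroup_def intro: add.subgroups_Inter_pair)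
next
  fix a assume a: "a \<in> I"
  then have ac: "a \<in> carrier R" using I by (rule additive_subgroup.a_Hcarr[rotated])
  show "\<exists>!f. (\<forall>n. f n \<in> I \<inter> G n) \<and> finite {n. f n \<noteq> \<zero>} \<and> a = finsum R f {n. f n \<noteq> \<zero>}"
  proof (rule ex1I[of _ "comp a"])
    fix f assume "(\<forall>n. f n \<in> I \<inter> G n) \<and> finite {n. f n \<noteq> \<zero>} \<and> a = finsum R f {n. f n \<noteq> \<zero>}"
    then show "f = comp a"
      using comp_eqI[of f "{n. f n \<noteq> \<zero>}" a] by simp
  qed (use comp a comp_in_G[OF ac] finite_comp[OF ac] finsum_comp[OF ac] in auto)
qed auto

text \<open>If every component of \<open>a\<close> vanished, \<open>a\<close> would be the empty
  sum.\<close>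

lemma graded_nonzero_homogeneous:
  assumes "internal_direct_sum R I (\<lambda>n. I \<inter> G n)" and "a \<in> I" and "a \<noteq> \<zero>"
  obtains b n where "b \<in> I" "b \<in> G n" "b \<noteq> \<zero>"
proof -
  have "\<exists>!f. (\<forall>n. f n \<in> I \<inter> G n) \<and> finite {n. f n \<noteq> \<zero>} \<and>
      a = finsum R f {n. f n \<noteq> \<zero>}"
    using assms(1,2) by (simp add: internal_direct_sum_def)
  then obtain f where f: "\<forall>n. f n \<in> I \<inter> G n" "a = finsum R f {n. f n \<noteq> \<zero>}"
    by (elim ex1E conjE) (rule that)
  have "{n. f n \<noteq> \<zero>} \<noteq> {}"
  proof
    assume "{n. f n \<noteq> \<zero>} = {}"
    with f(2) have "a = \<zero>" by (simp only: finsum_empty)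
    with \<open>a \<noteq> \<zero>\<close> show False ..
  qed
  then obtain n where "f n \<noteq> \<zero>" by blast
  with f(1) show thesis by (intro that[of "f n" n]) auto
qed

end

section \<open>The differential and the graded ring of cycles\<close>

context dg_ring
begin

sublocale d: abelian_group_hom R R d
  by (intro abelian_group_homI group_hom.intro group_hom_axioms.intro
    abelian_group_axioms add.group_axioms d_additive)

abbreviation cycles :: "'a set" where "cycles \<equiv> a_kernel R R d"

lemma cycles_iff: "a \<in> cycles \<longleftrightarrow> a \<in> carrier R \<and> d a = \<zero>"
  unfolding a_kernel_def' by (rule mem_Collect_eq)

lemma comp_d:
  assumes "a \<in> carrier R"
  shows "comp (d a) (n + 1) = d (comp a n)"
  using assms
proof (induction a rule: carrier_induct)
  case (homogeneous k a)
  then show ?case using comp_homogeneous[OF d_degree] by (auto simp: comp_homogeneous)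
next
  case (add a b)
  then show ?case using comp_closed by (simp add: comp_add)
qed

text \<open>By \<open>comp_d\<close>, applying \<open>d\<close> to a component of \<open>a\<close>
  gives a component of \<open>d a\<close>, which is zero. This makes induction over homogeneous
  cycles available.\<close>

lemma comp_cycle: "\<forall>a\<in>cycles. \<forall>n. comp a n \<in> cycles"
proof (intro ballI allI)
  fix a n assume "a \<in> cycles"
  then have a: "a \<in> carrier R" "d a = \<zero>" by (simp_all add: cycles_iff)
  then have "d (comp a n) = comp \<zero> (n + 1)" using comp_d[of a n] by simp
  also have "\<dots> = \<zero>" by (simp add: comp_homogeneous[OF zero_in_G[of 0]])
  finally show "comp a n \<in> cycles" using comp_closed a by (simp add: cycles_iff)
qed

lemmas cycles_induct [consumes 1, case_names homogeneous add] =
  graded_induct[OF d.additive_subgroup_a_kernel comp_cycle]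

text \<open>For homogeneous \<open>a\<close> the second Leibniz term contains
  \<open>d u = \<zero>\<close>. The remaining formula has no sign and extends additively.\<close>

lemma d_mult_cycle_right:
  assumes u: "u \<in> G m" "u \<in> cycles" and "a \<in> carrier R"
  shows "d (a \<otimes> u) = d a \<otimes> u"
  using \<open>a \<in> carrier R\<close>
proof (induction a rule: carrier_induct)
  case (homogeneous k a)
  then show ?case using leibniz[OF _ u(1)] u by (auto simp: cycles_iff)
next
  case (add a b)
  then show ?case using u by (simp add: l_distr cycles_iff)
qed

text \<open>Now the first Leibniz term vanishes. The sign left over depends only on the degree of
  \<open>u\<close>, so the formula is still additive in \<open>a\<close>.\<close>

lemma d_mult_cycle_left:
  assumes u: "u \<in> G m" "u \<in> cycles" and "a \<in> carrier R"
  shows "d (u \<otimes> a) = (if even m then u \<otimes> d a else \<ominus> (u \<otimes> d a))"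
  using \<open>a \<in> carrier R\<close>
proof (induction a rule: carrier_induct)
  case (homogeneous k a)
  then show ?case using leibniz[OF u(1)] u by (auto simp: cycles_iff)
next
  case (add a b)
  then show ?case using u by (simp add: r_distr cycles_iff minus_add)
qed

text \<open>As \<open>\<one>\<close> has even degree 0, Leibniz for
  \<open>\<one> \<otimes> \<one>\<close> reads
  \<open>d \<one> = d \<one> \<oplus> d \<one>\<close>.\<close>

lemma d_one: "d \<one> = \<zero>"
  using leibniz[OF one_in_G one_in_G] d.hom_closed[of \<one>] add.l_cancel_one by simp

text \<open>\<open>d_mult_cycle_right\<close> needs a homogeneous right factor, hence the induction
  on \<open>b\<close>, run inside the cycles so that its homogeneous parts are cycles too.\<close>

lemma cycles_mult_closed:
  assumes "b \<in> cycles" and a: "a \<in> cycles"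
  shows "a \<otimes> b \<in> cycles"
  using \<open>b \<in> cycles\<close>
proof (induction b rule: cycles_induct)
  case (homogeneous n b)
  then show ?case using a d_mult_cycle_right[of b n a] by (auto simp: cycles_iff)
next
  case (add b c)
  then show ?case using a by (auto simp: cycles_iff r_distr)
qed

lemma subring_cycles: "subring cycles R"
  by (rule subringI) (use cycles_mult_closed d_one in \<open>auto simp: cycles_iff\<close>)

lemma ring_cycle_ring: "ring (cycle_ring R d)"
  unfolding cycle_ring_def by (rule subring_is_ring[OF subring_cycles])

lemma finsum_cycle_ring:
  assumes "finite S" and "f \<in> S \<rightarrow> cycles"
  shows "finsum (cycle_ring R d) f S = finsum R f S"
proof -
  interpret K: ring "cycle_ring R d" by (rule ring_cycle_ring)
  show ?thesis
    unfolding cycle_ring_def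
    by (rule finsum_carrier_update[THEN conjunct1])
      (use K.abelian_monoid_axioms assms in \<open>auto simp: cycles_iff cycle_ring_def\<close>)
qed

lemma graded_ring_cycle_ring: "graded_ring (cycle_ring R d) (cycle_grading R G d)"
proof -
  interpret K: ring "cycle_ring R d" by (rule ring_cycle_ring)
  have sum: "internal_direct_sum R cycles (\<lambda>n. cycles \<inter> G n)"
    using d.additive_subgroup_a_kernel comp_cycle by (rule internal_direct_sumI)
  have "additive_subgroup (cycles \<inter> G n) (cycle_ring R d)" for n
  proof -
    have "subgroup (cycles \<inter> G n) (add_monoid R)"
      using sum by (simp add: internal_direct_sum_def additive_subgroup_def)
    from add.subgroup_incl[OF this] show ?thesis
      using d.additive_subgroup_a_kernel
      by (auto simp: additive_subgroup_def cycle_ring_def)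
  qed
  moreover have "\<exists>!f. (\<forall>n. f n \<in> cycles \<inter> G n) \<and> finite {n. f n \<noteq> \<zero>} \<and>
      a = finsum (cycle_ring R d) f {n. f n \<noteq> \<zero>}" if "a \<in> cycles" for a
  proof -
    \<comment> \<open>Families of cycles have the same sum in both rings, so existence and
      uniqueness transfer together.\<close>
    have "(\<forall>n. f n \<in> cycles \<inter> G n) \<and> finite {n. f n \<noteq> \<zero>} \<and>
        a = finsum (cycle_ring R d) f {n. f n \<noteq> \<zero>} \<longleftrightarrow>
      (\<forall>n. f n \<in> cycles \<inter> G n) \<and> finite {n. f n \<noteq> \<zero>} \<and> a = finsum R f {n. f n \<noteq> \<zero>}" for f
      using finsum_cycle_ring[of "{n. f n \<noteq> \<zero>}" f] by auto
    then show ?thesis using sum that by (simp add: internal_direct_sum_def)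
  qed
  ultimately have "internal_direct_sum (cycle_ring R d) cycles (\<lambda>n. cycles \<inter> G n)"
    by (auto simp: internal_direct_sum_def cycle_ring_def)
  moreover have "cycle_grading R G d = (\<lambda>n. cycles \<inter> G n)"
    by (auto simp: cycle_grading_def)
  ultimately show ?thesis
    by unfold_locales (auto simp: cycle_ring_def graded_mult cycles_mult_closed)
qed

section \<open>Principal dg-ideals and inverses of homogeneous cycles\<close>

lemma dg_left_ideal_principal:
  assumes u: "u \<in> G m" "u \<in> cycles"
  shows "dg_left_ideal R G d ((\<lambda>a. a \<otimes> u) ` carrier R)" (is "dg_left_ideal R G d ?I")
proof -
  have uc: "u \<in> carrier R" using G_closed[OF u(1)] .
  have sub: "additive_subgroup ?I R"
  proof (intro additive_subgroupI add.subgroupI)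
    fix x assume "x \<in> ?I"
    then show "\<ominus> x \<in> ?I"
      using uc by (force simp: l_minus[symmetric])
  next
    fix x y assume "x \<in> ?I" "y \<in> ?I"
    then show "x \<oplus> y \<in> ?I"
      using uc by (force simp: l_distr[symmetric])
  qed (use uc in auto)
  moreover have "r \<otimes> x \<in> ?I" if "r \<in> carrier R" "x \<in> ?I" for r x
    using that uc by (force simp: m_assoc[symmetric])
  \<comment> \<open>Each component of \<open>a \<otimes> u\<close> is a component of
    \<open>a\<close> times \<open>u\<close>, hence in \<open>?I\<close>.\<close>
  moreover have "internal_direct_sum R ?I (\<lambda>n. ?I \<inter> G n)"
    using sub by (rule internal_direct_sumI) (auto simp: comp_mult_right[OF _ u(1)] comp_closed)
  moreover have "d ` ?I \<subseteq> ?I"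
    by (auto simp: d_mult_cycle_right[OF u])
  ultimately show ?thesis by (simp add: dg_left_ideal_def)
qed

lemma dg_right_ideal_principal:
  assumes u: "u \<in> G m" "u \<in> cycles"
  shows "dg_right_ideal R G d ((\<lambda>a. u \<otimes> a) ` carrier R)" (is "dg_right_ideal R G d ?I")
proof -
  have uc: "u \<in> carrier R" using G_closed[OF u(1)] .
  have sub: "additive_subgroup ?I R"
  proof (intro additive_subgroupI add.subgroupI)
    fix x assume "x \<in> ?I"
    then show "\<ominus> x \<in> ?I"
      using uc by (force simp: r_minus[symmetric])
  next
    fix x y assume "x \<in> ?I" "y \<in> ?I"
    then show "x \<oplus> y \<in> ?I"
      using uc by (force simp: r_distr[symmetric])
  qed (use uc in auto)
  moreover have "x \<otimes> r \<in> ?I" if "r \<in> carrier R" "x \<in> ?I" for r x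
    using that uc by (force simp: m_assoc)
  moreover have "internal_direct_sum R ?I (\<lambda>n. ?I \<inter> G n)"
    using sub by (rule internal_direct_sumI) (auto simp: comp_mult_left[OF _ u(1)] comp_closed)
  \<comment> \<open>The possible sign in \<open>d (u \<otimes> a)\<close> is moved into the right
    factor, giving \<open>u \<otimes> (\<ominus> d a)\<close>.\<close>
  moreover have "d ` ?I \<subseteq> ?I"
    using uc by (auto simp: d_mult_cycle_left[OF u] r_minus[symmetric])
  ultimately show ?thesis by (simp add: dg_right_ideal_def)
qed

lemma Units_cycle_ringI:
  assumes "u \<in> G m" "u \<in> cycles"
    and v: "v \<in> carrier R" "v \<otimes> u = \<one>" and w: "w \<in> carrier R" "u \<otimes> w = \<one>"
  shows "u \<in> Units (cycle_ring R d)"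
proof -
  have u: "u \<in> carrier R" using assms(1) by (rule G_closed)
  have "v = w" using u v w by (metis l_one m_assoc r_one)
  have "d v \<otimes> u = \<zero>"
    using d_mult_cycle_right[OF assms(1,2) v(1)] v(2) d_one by simp
  \<comment> \<open>Multiply by \<open>w\<close> on the right and use
    \<open>u \<otimes> w = \<one>\<close>.\<close>
  then have "d v = \<zero>"
    using u v(1) w \<open>v = w\<close> by (metis d.hom_closed l_null m_assoc r_one)
  then have "v \<in> cycles" using v(1) by (simp add: cycles_iff)
  then show ?thesis
    using assms(2) v(2) w(2) \<open>v = w\<close> by (auto simp: Units_def cycle_ring_def)
qed

text \<open>The argument is purely additive, so it serves left and right dg-ideals alike.\<close>

lemma nonzero_homogeneous_cycle:
  assumes "internal_direct_sum R I (\<lambda>n. I \<inter> G n)" and "d ` I \<subseteq> I"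
    and "additive_subgroup I R" and "I \<noteq> {\<zero>}"
  obtains u where "u \<in> I" "u \<in> cycles" "homogeneous (cycle_grading R G d) u" "u \<noteq> \<zero>"
proof -
  have "\<zero> \<in> I" using assms(3) by (rule additive_subgroup.zero_closed)
  with \<open>I \<noteq> {\<zero>}\<close> obtain a where "a \<in> I" "a \<noteq> \<zero>" by blast
  with assms(1) obtain b n where b: "b \<in> I" "b \<in> G n" "b \<noteq> \<zero>"
    by (rule graded_nonzero_homogeneous)
  have bc: "b \<in> carrier R" using b(2) by (rule G_closed)
  show thesis
  proof (cases "d b = \<zero>")
    case True
    then show thesis
      using b bc by (intro that[of b]) (auto simp: homogeneous_def cycle_grading_def cycles_iff)
  next
    \<comment> \<open>Here \<open>d b\<close> is the cycle, since \<open>d\<close> squares to zero;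
      its degree is \<open>n + 1\<close>, and it stays in \<open>I\<close>.\<close>
    case False
    then show thesis
      using b bc d_degree[OF b(2)] d_squared[OF bc] assms(2)
      by (intro that[of "d b"]) (auto simp: homogeneous_def cycle_grading_def cycles_iff)
  qed
qed

end

section \<open>Dg-division of the whole ring against gr-division of its cycles\<close>

theorem theorem2p4:
  fixes A :: "('a, 'm) ring_scheme"
    and G :: "int \<Rightarrow> 'a set"
    and d :: "'a \<Rightarrow> 'a"
  assumes "dg_ring A G d"
    and "{u. homogeneous (cycle_grading A G d) u \<and> left_regular (cycle_ring A d) u} =
         {u. homogeneous (cycle_grading A G d) u \<and> right_regular (cycle_ring A d) u}"
  shows "dg_division_algebra A G d \<longleftrightarrow>
         gr_division_algebra (cycle_ring A d) (cycle_grading A G d)"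
proof -
  interpret dg_ring A G d by fact
  show ?thesis
  proof
    assume "dg_division_algebra A G d"
    then interpret D: dg_division_algebra A G d .
    have "u \<in> Units (cycle_ring A d)"
      if u: "homogeneous (cycle_grading A G d) u" "u \<noteq> \<zero>\<^bsub>A\<^esub>" for u
    proof -
      from u(1) obtain m where m: "u \<in> G m" "u \<in> cycles"
        by (auto simp: homogeneous_def cycle_grading_def)
      have uc: "u \<in> carrier A" using m(1) by (rule G_closed)
      \<comment> \<open>Taking the unit as cofactor puts \<open>u\<close> in both ideals, so neither
        of them is zero.\<close>
      have "u \<in> (\<lambda>a. a \<otimes>\<^bsub>A\<^esub> u) ` carrier A" "u \<in> (\<lambda>a. u \<otimes>\<^bsub>A\<^esub> a) ` carrier A"
        using uc by (force intro: image_eqI[where x = "\<one>\<^bsub>A\<^esub>"])+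
      then have "(\<lambda>a. a \<otimes>\<^bsub>A\<^esub> u) ` carrier A = carrier A"
        and "(\<lambda>a. u \<otimes>\<^bsub>A\<^esub> a) ` carrier A = carrier A"
        using D.dg_left_ideal_trivial[OF dg_left_ideal_principal[OF m]]
          D.dg_right_ideal_trivial[OF dg_right_ideal_principal[OF m]] u(2) by auto
      then have "\<one>\<^bsub>A\<^esub> \<in> (\<lambda>a. a \<otimes>\<^bsub>A\<^esub> u) ` carrier A" "\<one>\<^bsub>A\<^esub> \<in> (\<lambda>a. u \<otimes>\<^bsub>A\<^esub> a) ` carrier A"
        by simp_all
      then obtain v w
        where "v \<in> carrier A" "v \<otimes>\<^bsub>A\<^esub> u = \<one>\<^bsub>A\<^esub>" "w \<in> carrier A" "u \<otimes>\<^bsub>A\<^esub> w = \<one>\<^bsub>A\<^esub>"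
        by (elim imageE) (rule that, auto)
      with m show ?thesis by (rule Units_cycle_ringI)
    qed
    then show "gr_division_algebra (cycle_ring A d) (cycle_grading A G d)"
      by (intro gr_division_algebra.intro gr_division_algebra_axioms.intro graded_ring_cycle_ring)
        (simp add: cycle_ring_def)
  next
    assume "gr_division_algebra (cycle_ring A d) (cycle_grading A G d)"
    then interpret K: gr_division_algebra "cycle_ring A d" "cycle_grading A G d" .
    \<comment> \<open>The cycles share product and unit with \<open>A\<close>, so an inverse among
      them is an inverse in \<open>A\<close>.\<close>
    have inverse: "\<exists>v\<in>carrier A. v \<otimes>\<^bsub>A\<^esub> u = \<one>\<^bsub>A\<^esub> \<and> u \<otimes>\<^bsub>A\<^esub> v = \<one>\<^bsub>A\<^esub>"
      if "homogeneous (cycle_grading A G d) u" "u \<noteq> \<zero>\<^bsub>A\<^esub>" for u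
      using K.homogeneous_invertible[of u] that
      by (auto simp: Units_def cycle_ring_def cycles_iff)
    show "dg_division_algebra A G d"
    proof (intro dg_division_algebra.intro dg_division_algebra_axioms.intro dg_ring_axioms)
      fix I assume I: "dg_left_ideal A G d I"
      then have sub: "I \<subseteq> carrier A"
        by (auto simp: dg_left_ideal_def dest: additive_subgroup.a_subset)
      show "I = {\<zero>\<^bsub>A\<^esub>} \<or> I = carrier A"
      proof (unfold disj_imp, rule impI)
        assume "I \<noteq> {\<zero>\<^bsub>A\<^esub>}"
        then obtain u where u: "u \<in> I" "homogeneous (cycle_grading A G d) u" "u \<noteq> \<zero>\<^bsub>A\<^esub>"
          using I unfolding dg_left_ideal_def by (metis nonzero_homogeneous_cycle)
        from inverse[OF u(2,3)] obtain v
          where "v \<in> carrier A" "v \<otimes>\<^bsub>A\<^esub> u = \<one>\<^bsub>A\<^esub>" by blast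
        then have "\<one>\<^bsub>A\<^esub> \<in> I" using u(1) I unfolding dg_left_ideal_def by metis
        then have "r \<in> I" if "r \<in> carrier A" for r
          using I that r_one[of r] unfolding dg_left_ideal_def by metis
        then show "I = carrier A" using sub by blast
      qed
    next
      fix I assume I: "dg_right_ideal A G d I"
      then have sub: "I \<subseteq> carrier A"
        by (auto simp: dg_right_ideal_def dest: additive_subgroup.a_subset)
      show "I = {\<zero>\<^bsub>A\<^esub>} \<or> I = carrier A"
      proof (unfold disj_imp, rule impI)
        assume "I \<noteq> {\<zero>\<^bsub>A\<^esub>}"
        then obtain u where u: "u \<in> I" "homogeneous (cycle_grading A G d) u" "u \<noteq> \<zero>\<^bsub>A\<^esub>"
          using I unfolding dg_right_ideal_def by (metis nonzero_homogeneous_cycle)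
        \<comment> \<open>A right ideal absorbs factors on the right, so the other half of the
          inverse property is used here.\<close>
        from inverse[OF u(2,3)] obtain v
          where "v \<in> carrier A" "u \<otimes>\<^bsub>A\<^esub> v = \<one>\<^bsub>A\<^esub>" by blast
        then have "\<one>\<^bsub>A\<^esub> \<in> I" using u(1) I unfolding dg_right_ideal_def by metis
        then have "r \<in> I" if "r \<in> carrier A" for r
          using I that l_one[of r] unfolding dg_right_ideal_def by metis
        then show "I = carrier A" using sub by blast
      qed
    qed
  qed
qed

end
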